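(* Let $L\ge 1$ and let $\gamma_1,\dots,\gamma_L$ be independent random variables, where $\gamma_\ell$ follows the Fisher-Snedecor $\mathcal{F}$ distribution with parameters $(\bar\gamma_\ell, m_\ell, m_{s_\ell})$, $\bar\gamma_\ell>0$, $m_\ell>0$, $m_{s_\ell}>1$. Let $Z=\gamma_1+\cdots+\gamma_L$ and set $x_\ell=\frac{m_\ell}{(m_{s_\ell}-1)\bar\gamma_\ell}$. Then for $z>0$ the cumulative distribution function of $Z$ is $$F_Z(z)=\frac{1}{\prod_{\ell=1}^L\Gamma(m_\ell)\Gamma(m_{s_\ell})}\,H_{0,1:2,1;2,1;\cdots;2,1}^{0,0:1,2;1,2;\cdots;1,2}\left(\left.\begin{array}{c}x_1 z\\ \vdots\\ x_L z\end{array}\right|\begin{array}{c} - :(1,1),(1-m_{s_1},1);\cdots;(1,1),(1-m_{s_L},1)\\ (0;1,\dots,1):(m_1,1);\cdots;(m_L,1)\end{array}\right).$$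
   Context: The Fisher-Snedecor $\mathcal{F}$ distribution with parameters $(\bar\gamma,m,m_s)$, $\bar\gamma>0$, $m>0$, $m_s>1$, is the distribution on $(0,\infty)$ with density $f(\gamma)=\frac{m^m(m_s-1)^{m_s}\bar\gamma^{m_s}\gamma^{m-1}}{B(m,m_s)\,(m\gamma+(m_s-1)\bar\gamma)^{m+m_s}}$, where $B$ is the beta function. Multivariate Fox $H$-function: for $r$ complex variables, $$H_{p,q:p_1,q_1;\dots;p_r,q_r}^{0,n:m_1,n_1;\dots;m_r,n_r}\left(\left.\begin{array}{c}z_1\\ \vdots\\ z_r\end{array}\right|\begin{array}{c}(a_j;\alpha_j^{(1)},\dots,\alpha_j^{(r)})_{1,p}:(c_j^{(1)},\gamma_j^{(1)})_{1,p_1};\cdots;(c_j^{(r)},\gamma_j^{(r)})_{1,p_r}\\ (b_j;\beta_j^{(1)},\dots,\beta_j^{(r)})_{1,q}:(d_j^{(1)},\delta_j^{(1)})_{1,q_1};\cdots;(d_j^{(r)},\delta_j^{(r)})_{1,q_r}\end{array}\right)=\frac{1}{(2\pi i)^r}\int_{L_1}\!\!\cdots\!\int_{L_r}\Psi(\zeta_1,\dots,\zeta_r)\prod_{k=1}^r\phi_k(\zeta_k)z_k^{\zeta_k}\,d\zeta_1\cdots d\zeta_r,$$ with $\Psi=\frac{\prod_{j=1}^n\Gamma(1-a_j+\sum_k\alpha_j^{(k)}\zeta_k)}{\prod_{j=n+1}^p\Gamma(a_j-\sum_k\alpha_j^{(k)}\zeta_k)\prod_{j=1}^q\Gamma(1-b_j+\sum_k\beta_j^{(k)}\zeta_k)}$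 and $\phi_k(\zeta)=\frac{\prod_{\lambda=1}^{m_k}\Gamma(d_\lambda^{(k)}-\delta_\lambda^{(k)}\zeta)\prod_{j=1}^{n_k}\Gamma(1-c_j^{(k)}+\gamma_j^{(k)}\zeta)}{\prod_{j=n_k+1}^{p_k}\Gamma(c_j^{(k)}-\gamma_j^{(k)}\zeta)\prod_{\lambda=m_k+1}^{q_k}\Gamma(1-d_\lambda^{(k)}+\delta_\lambda^{(k)}\zeta)}$; the $L_k$ are the standard Mellin–Barnes contours (vertical lines separating the poles of the $\Gamma(d-\delta\zeta)$ factors from those of the $\Gamma(1-c+\gamma\zeta)$ and $\Gamma(1-a+\sum\alpha\zeta)$ factors, chosen so the integral converges). A "$-$" denotes an empty parameter list. *)

theory Defs
  imports "HOL-Probability.Probability"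
begin

definition fisherF_density :: "real \<Rightarrow> real \<Rightarrow> real \<Rightarrow> real \<Rightarrow> real" where
  "fisherF_density gbar m ms g =
     (if g > 0 then
        m powr m * (ms - 1) powr ms * gbar powr ms * g powr (m - 1)
        / (Beta m ms * (m * g + (ms - 1) * gbar) powr (m + ms))
      else 0)"

definition mfox_lin :: "real list \<Rightarrow> (nat \<Rightarrow> complex) \<Rightarrow> complex" where
  "mfox_lin al \<zeta> = (\<Sum>k<length al. complex_of_real (al ! k) * \<zeta> k)"

(* Psi: A = [(a_j, [alpha_j^(1),...,alpha_j^(r)])]_{j=1..p},
        B = [(b_j, [beta_j^(1),...,beta_j^(r)])]_{j=1..q}; 1/Gamma written as rGamma *)
definition mfox_Psi ::
  "nat \<Rightarrow> (real \<times> real list) list \<Rightarrow> (real \<times> real list) list \<Rightarrow> (nat \<Rightarrow> complex) \<Rightarrow> complex" where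
  "mfox_Psi n A B \<zeta> =
     (\<Prod>j<n. Gamma (1 - complex_of_real (fst (A ! j)) + mfox_lin (snd (A ! j)) \<zeta>)) *
     (\<Prod>j\<in>{n..<length A}. rGamma (complex_of_real (fst (A ! j)) - mfox_lin (snd (A ! j)) \<zeta>)) *
     (\<Prod>j<length B. rGamma (1 - complex_of_real (fst (B ! j)) + mfox_lin (snd (B ! j)) \<zeta>))"

(* phi_k: C = [(c_j,gamma_j)]_{j=1..p_k}, D = [(d_l,delta_l)]_{l=1..q_k} *)
definition mfox_phi ::
  "nat \<Rightarrow> nat \<Rightarrow> (real \<times> real) list \<Rightarrow> (real \<times> real) list \<Rightarrow> complex \<Rightarrow> complex" where
  "mfox_phi mk nk C D s =
     (\<Prod>l<mk. Gamma (complex_of_real (fst (D ! l)) - complex_of_real (snd (D ! l)) * s)) *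
     (\<Prod>j<nk. Gamma (1 - complex_of_real (fst (C ! j)) + complex_of_real (snd (C ! j)) * s)) *
     (\<Prod>j\<in>{nk..<length C}. rGamma (complex_of_real (fst (C ! j)) - complex_of_real (snd (C ! j)) * s)) *
     (\<Prod>l\<in>{mk..<length D}. rGamma (1 - complex_of_real (fst (D ! l)) + complex_of_real (snd (D ! l)) * s))"

(* Multivariate Fox H-function.  K ! k = (m_k, n_k, C_k, D_k); zs = [z_1..z_r];
   cs ! k = abscissa of the vertical contour L_k = cs!k + i R (traversed upward).
   (2 pi i)^{-r} \<integral>_{L_1..L_r} ... d\<zeta> = (2 pi)^{-r} \<integral>_{R^r} ... (cs + i t) dt. *)
definition mfoxH ::
  "nat \<Rightarrow> (real \<times> real list) list \<Rightarrow> (real \<times> real list) list \<Rightarrow>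
   (nat \<times> nat \<times> (real \<times> real) list \<times> (real \<times> real) list) list \<Rightarrow>
   complex list \<Rightarrow> real list \<Rightarrow> complex" where
  "mfoxH n A B K zs cs =
     complex_of_real (1 / (2 * pi) ^ length zs) *
     (LINT t | PiM {..<length zs} (\<lambda>_. lborel).
        (let \<zeta> = (\<lambda>k. complex_of_real (cs ! k) + \<i> * complex_of_real (t k)) in
         mfox_Psi n A B \<zeta> *
         (\<Prod>k<length zs. (case K ! k of (mk, nk, C, D) \<Rightarrow> mfox_phi mk nk C D (\<zeta> k))
                          * (zs ! k) powr (\<zeta> k))))"

(* Standard Mellin-Barnes contours: L_k separates the poles of Gamma(d-delta zeta)
   from those of Gamma(1-c+gamma zeta) and of Gamma(1-a+sum alpha zeta)
   (all delta, gamma > 0 in the cases considered). *)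
definition mfox_admissible ::
  "nat \<Rightarrow> (real \<times> real list) list \<Rightarrow>
   (nat \<times> nat \<times> (real \<times> real) list \<times> (real \<times> real) list) list \<Rightarrow> real list \<Rightarrow> bool" where
  "mfox_admissible n A K cs \<longleftrightarrow>
     length cs = length K \<and>
     (\<forall>k<length K. case K ! k of (mk, nk, C, D) \<Rightarrow>
        (\<forall>l<mk. cs ! k < fst (D ! l) / snd (D ! l)) \<and>
        (\<forall>j<nk. (fst (C ! j) - 1) / snd (C ! j) < cs ! k)) \<and>
     (\<forall>j<n. 0 < 1 - fst (A ! j) + (\<Sum>k<length (snd (A ! j)). (snd (A ! j)) ! k * cs ! k))"

end

theory Submission
  imports Defs "HOL-Real_Asymp.Real_Asymp"
begin

text \<open>
  In the logarithmic variable, the tilted Fisher-Snedecor density is a logistic-type function whose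
  Fourier transform is a Beta function on a vertical line. Fourier inversion thus writes the density
  of the \<open>l\<close>-th summand as a Mellin-Barnes integral of
  \<open>Gamma (m - \<zeta>) * Gamma (ms + \<zeta>) * x powr \<zeta> * g powr (\<zeta> - 1)\<close> along \<open>Re \<zeta> = c\<close>, \<open>0 < c < m\<close>.
  The distribution function of the sum is the integral of the product of the densities over the
  simplex \<open>\<Sum>g \<le> z\<close>. Since \<open>c > 0\<close>, everything converges absolutely and Fubini's theorem applies;
  the inner integral is the Dirichlet integral, which contributes the remaining factors
  \<open>Gamma \<zeta>\<close>, the factor \<open>rGamma (1 + \<Sum>\<zeta>)\<close> and the power of \<open>z\<close>.
\<close>

section \<open>Gamma and Beta integrals in logarithmic variables\<close>

lemma Re_pos_not_nonpos_Int: "Re a > 0 \<Longrightarrow> a \<notin> \<int>\<^sub>\<le>\<^sub>0"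
  by (auto elim!: nonpos_Ints_cases)

text \<open>The nonnegative substitution rule applied to \<open>norm f\<close> yields integrability
  over the target interval from that over the source; only then does the vector-valued rule give the
  equality.\<close>

lemma interval_integral_substitution_complex:
  fixes f :: "real \<Rightarrow> complex" and a b A B :: ereal
  assumes "a < b"
    and deriv_g: "\<And>x. a < ereal x \<Longrightarrow> ereal x < b \<Longrightarrow> DERIV g x :> g' x"
    and contf: "\<And>x. a < ereal x \<Longrightarrow> ereal x < b \<Longrightarrow> isCont f (g x)"
    and contg': "\<And>x. a < ereal x \<Longrightarrow> ereal x < b \<Longrightarrow> isCont g' x"
    and g'_nonneg: "\<And>x. a \<le> ereal x \<Longrightarrow> ereal x \<le> b \<Longrightarrow> 0 \<le> g' x"
    and A: "((ereal \<circ> g \<circ> real_of_ereal) \<longlongrightarrow> A) (at_right a)"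
    and B: "((ereal \<circ> g \<circ> real_of_ereal) \<longlongrightarrow> B) (at_left b)"
    and int: "set_integrable lborel (einterval a b) (\<lambda>x. g' x *\<^sub>R f (g x))"
    and meas: "set_borel_measurable lborel (einterval A B) f"
  shows "set_integrable lborel (einterval A B) f"
    and "(LBINT x=A..B. f x) = (LBINT x=a..b. g' x *\<^sub>R f (g x))"
proof -
  have "set_integrable lborel (einterval a b) (\<lambda>x. norm (g' x *\<^sub>R f (g x)))"
    using int by (rule set_integrable_norm)
  also have "?this \<longleftrightarrow> set_integrable lborel (einterval a b) (\<lambda>x. norm (f (g x)) * g' x)"
    using g'_nonneg by (intro set_integrable_cong) (auto simp: einterval_def)
  finally have "set_integrable lborel (einterval A B) (\<lambda>x. norm (f x))"
    by (intro interval_integral_substitution_nonneg(1)[where g = g and g' = g', OF \<open>a < b\<close> deriv_g _ contg' _ g'_nonneg A B])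
       (auto intro!: contf continuous_norm)
  then show *: "set_integrable lborel (einterval A B) f"
    using meas unfolding set_integrable_def set_borel_measurable_def
    by (subst integrable_norm_iff[symmetric]) auto
  show "(LBINT x=A..B. f x) = (LBINT x=a..b. g' x *\<^sub>R f (g x))"
    by (rule interval_integral_substitution_integrable[OF \<open>a < b\<close> deriv_g contf contg' g'_nonneg A B int *])
qed

text \<open>Euler's integral under \<open>t = exp x\<close>: the measure \<open>dt / t\<close>
  becomes \<open>dx\<close>, so that scaling of \<open>t\<close> turns into translation of
  \<open>x\<close>. The substitution is run backwards, with \<open>ln\<close> carrying the half-line
  to the whole line.\<close>

lemma has_bochner_integral_Gamma_exp:
  fixes a :: complex
  assumes "Re a > 0"
  shows "has_bochner_integral lborel (\<lambda>x::real. exp (a * of_real x - of_real (exp x))) (Gamma a)"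
proof -
  let ?f = "\<lambda>x::real. exp (a * of_real x - of_real (exp x))"
  let ?h = "\<lambda>t::real. complex_of_real t powr (a - 1) / of_real (exp t)"
  have e: "einterval 0 \<infinity> = {0::real<..}" "einterval (-\<infinity>) \<infinity> = (UNIV :: real set)"
    by (auto simp: einterval_def zero_ereal_def)
  have eq: "(1 / x) *\<^sub>R ?f (ln x) = ?h x" if "x > 0" for x
    using that by (simp add: powr_def exp_diff scaleR_conv_of_real algebra_simps Ln_of_real exp_of_real)
  have h: "?h absolutely_integrable_on {0<..}"
    by (rule absolutely_integrable_Gamma_integral'[OF assms])
  have meas: "set_borel_measurable lborel {0<..} ?h"
    unfolding set_borel_measurable_def
    by (auto intro!: borel_measurable_continuous_on_indicator continuous_intros)
  \<comment> \<open>Absolute integrability refers to the completed measure; Borel measurability of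
    the integrand brings it back to \<open>lborel\<close>.\<close>
  have hl: "set_integrable lborel {0<..} ?h"
    using h meas unfolding set_integrable_def set_borel_measurable_def
    by (subst (asm) integrable_completion) auto
  have gl: "(LBINT x:{0<..}. ?h x) = Gamma a"
    using set_borel_integral_eq_integral(2)[OF hl] Gamma_integral_complex'[OF assms] by (simp add: integral_unique)
  have int: "set_integrable lborel (einterval 0 \<infinity>) (\<lambda>x. (1 / x) *\<^sub>R ?f (ln x))"
    unfolding e by (subst set_integrable_cong[OF refl refl eq]) (auto simp: hl)
  have A: "((ereal \<circ> ln \<circ> real_of_ereal) \<longlongrightarrow> -\<infinity>) (at_right (0::ereal))"
    unfolding zero_ereal_def ereal_tendsto_simps by (rule ln_at_0)
  have B: "((ereal \<circ> ln \<circ> real_of_ereal) \<longlongrightarrow> \<infinity>) (at_left (\<infinity>::ereal))"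
    unfolding ereal_tendsto_simps by (rule ln_at_top)
  have sub: "set_integrable lborel (einterval (-\<infinity>) \<infinity>) ?f"
      "(LBINT x=-\<infinity>..\<infinity>. ?f x) = (LBINT x=0..\<infinity>. (1 / x) *\<^sub>R ?f (ln x))"
    by (rule interval_integral_substitution_complex[OF _ _ _ _ _ A B int]; 
       force intro!: DERIV_ln_divide continuous_intros simp: set_borel_measurable_def)+
  have "(LBINT x=0..\<infinity>. (1 / x) *\<^sub>R ?f (ln x)) = (LBINT x:{0<..}. ?h x)"
    unfolding interval_lebesgue_integral_0_infty
    by (rule set_lebesgue_integral_cong) (use eq in auto)
  then show ?thesis
    using sub gl by (simp add: has_bochner_integral_iff e interval_lebesgue_integral_def set_lebesgue_integral_def set_integrable_def)
qed

lemma has_bochner_integral_Gamma_exp_real: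
  fixes a :: real
  assumes "a > 0"
  shows "has_bochner_integral lborel (\<lambda>x. exp (a * x - exp x)) (Gamma a)"
proof -
  have "has_bochner_integral lborel (\<lambda>x. complex_of_real (exp (a * x - exp x))) (of_real (Gamma a))"
    using has_bochner_integral_Gamma_exp[of "of_real a"] assms
    by (simp add: Gamma_complex_of_real flip: exp_of_real)
  then show ?thesis
    by (simp add: has_bochner_integral_iff complex_of_real_integrable_eq)
qed

text \<open>
  Substituting \<open>x \<mapsto> x + y\<close> and then \<open>y \<mapsto> y - ln (1 + exp x)\<close> in the double integral for
  \<open>Gamma a * Gamma b\<close> (both in logarithmic variables) splits off \<open>Gamma (a + b)\<close>,
  so only translations of Lebesgue measure are needed.
\<close>

lemma has_bochner_integral_Beta_logistic:
  fixes a b :: complex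
  assumes "Re a > 0" "Re b > 0"
  shows "has_bochner_integral lborel
           (\<lambda>x::real. exp (a * of_real x - (a + b) * of_real (ln (1 + exp x)))) (Beta a b)"
proof -
  let ?g = "\<lambda>x::real. exp (a * of_real x - (a + b) * of_real (ln (1 + exp x)))"
  define h :: "real \<times> real \<Rightarrow> complex" where
    "h = (\<lambda>(y, x). exp (a * of_real x + (a + b) * of_real y - of_real (exp y * (1 + exp x))))"
  have [measurable]: "h \<in> borel_measurable (lborel \<Otimes>\<^sub>M lborel)"
    unfolding h_def lborel_prod by (auto intro!: borel_measurable_continuous_onI continuous_intros simp: case_prod_beta)
  \<comment> \<open>The factor \<open>1 *\<close> is kept so that the affine substitution rule
    matches with scale 1; \<open>hy\<close> below uses the same form.\<close>
  have hx: "h (y, x) = exp (b * of_real y - of_real (exp y)) *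
      exp (a * of_real (y + 1 * x) - of_real (exp (y + 1 * x)))" for x y
    by (simp add: h_def exp_add[symmetric] algebra_simps)
  have ix: "has_bochner_integral lborel (\<lambda>x. h (y, x))
      (exp (b * of_real y - of_real (exp y)) * Gamma a)" for y
    unfolding hx using lborel_has_bochner_integral_real_affine_iff[of 1
      "\<lambda>x. exp (a * of_real x - of_real (exp x))" "Gamma a" y] has_bochner_integral_Gamma_exp[OF assms(1)]
    by (intro has_bochner_integral_mult_right) auto
  \<comment> \<open>Here \<open>exp y * (1 + exp x) = exp (y + ln (1 + exp x))\<close>, so for fixed
    \<open>x\<close> the integrand in \<open>y\<close> is a translated integrand of
    \<open>Gamma (a + b)\<close>.\<close>
  have hy: "h (y, x) = ?g x *
      exp ((a + b) * of_real (ln (1 + exp x) + 1 * y) - of_real (exp (ln (1 + exp x) + 1 * y)))" for x y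
  proof -
    have "1 + exp x > 0" by (simp add: add_pos_pos)
    then show ?thesis
    by (simp add: h_def exp_add[symmetric] algebra_simps) (simp add: exp_add algebra_simps)
  qed
  have iy: "has_bochner_integral lborel (\<lambda>y. h (y, x)) (?g x * Gamma (a + b))" for x
    unfolding hy using lborel_has_bochner_integral_real_affine_iff[of 1
      "\<lambda>x. exp ((a + b) * of_real x - of_real (exp x))" "Gamma (a + b)" "ln (1 + exp x)"]
      has_bochner_integral_Gamma_exp[of "a + b"] assms
    by (intro has_bochner_integral_mult_right) auto
  have int: "integrable (lborel \<Otimes>\<^sub>M lborel) h"
  proof (rule lborel_pair.Fubini_integrable)
    have n: "(\<integral>x. norm (h (y, x)) \<partial>lborel) = exp (Re b * y - exp y) * (\<integral>x. exp (Re a * x - exp x) \<partial>lborel)" for y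
      unfolding hx norm_mult norm_exp_eq_Re
      using lborel_integral_real_affine[of 1 "\<lambda>x. exp (Re a * x - exp x)" y] by simp
    show "integrable lborel (\<lambda>y. \<integral>x. norm (h (y, x)) \<partial>lborel)"
      unfolding n using has_bochner_integral_Gamma_exp_real[OF assms(2)]
      by (intro integrable_mult_left) (simp add: has_bochner_integral_iff)
    show "AE x in lborel. complex_integrable lborel (\<lambda>y. h (x, y))"
      using ix by (auto simp: has_bochner_integral_iff)
  qed simp
  have G0: "Gamma (a + b) \<noteq> 0"
    using Re_pos_not_nonpos_Int[of "a + b"] assms by (simp add: Gamma_eq_zero_iff)
  have "integrable lborel (\<lambda>x. \<integral>y. h (y, x) \<partial>lborel)"
    using lborel_pair.integrable_snd[of "\<lambda>y x. h (y, x)"] int by simp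
  moreover have "(\<lambda>x. \<integral>y. h (y, x) \<partial>lborel) = (\<lambda>x. ?g x * Gamma (a + b))"
    using iy by (simp add: has_bochner_integral_iff)
  ultimately have "integrable lborel (\<lambda>x. ?g x * Gamma (a + b) * inverse (Gamma (a + b)))"
    by - (rule integrable_mult_left, simp)
  then have gint: "integrable lborel ?g"
    using G0 by (simp add: mult.assoc)
  have "(\<integral>x. \<integral>y. h (y, x) \<partial>lborel \<partial>lborel) = (\<integral>y. \<integral>x. h (y, x) \<partial>lborel \<partial>lborel)"
    using lborel_pair.Fubini_integral[of "\<lambda>y x. h (y, x)"] int by simp
  also have "(\<integral>y. \<integral>x. h (y, x) \<partial>lborel \<partial>lborel) = Gamma b * Gamma a"
    using ix has_bochner_integral_Gamma_exp[OF assms(2)] by (simp add: has_bochner_integral_iff)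
  also have "(\<integral>x. \<integral>y. h (y, x) \<partial>lborel \<partial>lborel) = (\<integral>x. ?g x \<partial>lborel) * Gamma (a + b)"
    using iy gint by (simp add: has_bochner_integral_iff)
  finally show ?thesis
    using gint G0 by (simp add: has_bochner_integral_iff Beta_def field_simps)
qed

section \<open>Truncated powers and their convolution\<close>

text \<open>The Riemann-Liouville kernel without its factor \<open>1 / Gamma a\<close>. The value 0
  off the positive half-line encodes the constraints of the simplex, so every integral can run over
  the full space.\<close>

definition euler_kernel :: "complex \<Rightarrow> real \<Rightarrow> complex" where
  "euler_kernel a x = (if x > 0 then of_real x powr (a - 1) else 0)"

lemma euler_kernel_1: "euler_kernel 1 x = indicator {0<..} x"
  by (simp add: euler_kernel_def)

text \<open>The exponent varies too, because Fubini's theorem is later applied jointly in the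
  contour variable and the position.\<close>

lemma euler_kernel_measurable [measurable (raw)]:
  assumes [measurable]: "f \<in> borel_measurable M" "g \<in> borel_measurable M"
  shows "(\<lambda>x. euler_kernel (f x) (g x)) \<in> borel_measurable M"
proof -
  have "(\<lambda>x. euler_kernel (f x) (g x)) = (\<lambda>x. if g x > 0 then exp ((f x - 1) * of_real (ln (g x))) else 0)"
    by (auto simp: euler_kernel_def powr_def Ln_of_real)
  then show ?thesis by simp
qed

text \<open>The modulus of a positive number raised to a complex power depends only on the real part
  of the exponent. Norm integrals thereby become instances of the complex formulas at real
  exponents.\<close>

lemma of_real_norm_euler_kernel: "of_real (norm (euler_kernel a x)) = euler_kernel (of_real (Re a)) x"
  by (simp add: euler_kernel_def norm_powr_real_powr powr_of_real[symmetric])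

text \<open>For \<open>w > 0\<close> the logistic map \<open>g\<close> sends the line onto the
  interval from 0 to \<open>w\<close> with \<open>g x / (w - g x) = exp x\<close>, and the
  convolution becomes the logistic form of the Beta integral.\<close>

lemma euler_kernel_convolution:
  assumes "Re a > 0" "Re b > 0"
  shows "has_bochner_integral lborel (\<lambda>x. euler_kernel a x * euler_kernel b (w - x))
           (Beta a b * euler_kernel (a + b) w)"
proof (cases "w > 0")
  case False
  then have "(\<lambda>x. euler_kernel a x * euler_kernel b (w - x)) = (\<lambda>_. 0)"
    by (auto simp: euler_kernel_def fun_eq_iff)
  then show ?thesis using False by (simp add: euler_kernel_def[of _ w] has_bochner_integral_zero)
next
  case True
  let ?f = "\<lambda>x. euler_kernel a x * euler_kernel b (w - x)"
  let ?l = "\<lambda>x::real. exp (a * of_real x - (a + b) * of_real (ln (1 + exp x)))"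
  define g where "g = (\<lambda>x::real. w * exp x / (1 + exp x))"
  define g' where "g' = (\<lambda>x::real. w * exp x / (1 + exp x)\<^sup>2)"
  have p: "1 + exp x > 0" "1 + exp x \<noteq> 0" for x :: real
    using exp_gt_zero[of x] by linarith+
  \<comment> \<open>Since \<open>g' = g * (w - g) / w\<close>, the derivative raises both exponents
    by one; in logarithms the comparison in \<open>eq\<close> is linear.\<close>
  have lng: "ln (g x) = ln w + x - ln (1 + exp x)" "ln (w - g x) = ln w - ln (1 + exp x)"
      "ln (g' x) = ln w + x - 2 * ln (1 + exp x)" and gp: "g x > 0" "w - g x > 0" "g' x > 0" for x
  proof -
    have w: "w - g x = w / (1 + exp x)" using p[of x] by (simp add: g_def field_simps)
    show "ln (g x) = ln w + x - ln (1 + exp x)" "ln (w - g x) = ln w - ln (1 + exp x)"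
      "ln (g' x) = ln w + x - 2 * ln (1 + exp x)" "g x > 0" "w - g x > 0" "g' x > 0"
      unfolding w using p[of x] True by (auto simp: g_def g'_def ln_div ln_mult ln_realpow)
  qed
  have eq: "g' x *\<^sub>R ?f (g x) = of_real w powr (a + b - 1) * ?l x" for x
  proof -
    have "g' x *\<^sub>R ?f (g x) = exp (of_real (ln (g' x)) + (a - 1) * of_real (ln (g x)) + (b - 1) * of_real (ln (w - g x)))"
      using gp[of x] by (simp add: euler_kernel_def powr_def Ln_of_real scaleR_conv_of_real exp_add exp_of_real
        del: of_real_diff)
    also have "\<dots> = exp ((a + b - 1) * of_real (ln w) + (a * of_real x - (a + b) * of_real (ln (1 + exp x))))"
      unfolding lng by (simp add: algebra_simps)
    also have "\<dots> = of_real w powr (a + b - 1) * ?l x"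
      using True by (simp add: exp_add powr_def Ln_of_real)
    finally show ?thesis .
  qed
  have e: "einterval 0 (ereal w) = {0::real<..<w}" "einterval (-\<infinity>) \<infinity> = (UNIV :: real set)"
    by (auto simp: einterval_def zero_ereal_def)
  have int: "set_integrable lborel (einterval (-\<infinity>) \<infinity>) (\<lambda>x. g' x *\<^sub>R ?f (g x))"
    unfolding eq e set_integrable_def using has_bochner_integral_Beta_logistic[OF assms]
    by (simp add: has_bochner_integral_iff)
  have A: "((ereal \<circ> g \<circ> real_of_ereal) \<longlongrightarrow> 0) (at_right (-\<infinity>::ereal))"
    unfolding zero_ereal_def ereal_tendsto_simps g_def using True by real_asymp
  have B: "((ereal \<circ> g \<circ> real_of_ereal) \<longlongrightarrow> ereal w) (at_left (\<infinity>::ereal))"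
    unfolding ereal_tendsto_simps g_def using True by real_asymp
  have D: "(g has_real_derivative g' x) (at x)" for x
    unfolding g_def g'_def using p[of x]
    by (auto intro!: derivative_eq_intros simp: field_simps power2_eq_square)
  have C: "isCont ?f (g x)" for x
  proof -
    have "eventually (\<lambda>y. y \<in> {0<..<w}) (nhds (g x))"
      using gp[of x] by (intro eventually_nhds_in_open) auto
    then have "eventually (\<lambda>y. ?f y = of_real y powr (a - 1) * of_real (w - y) powr (b - 1)) (nhds (g x))"
      by eventually_elim (auto simp: euler_kernel_def)
    then show ?thesis
      using gp[of x] by (subst isCont_cong) (auto intro!: continuous_intros simp del: of_real_diff)
  qed
  have C': "isCont g' x" for x
    unfolding g'_def using p[of x] by (auto intro!: continuous_intros)
  have sub: "set_integrable lborel (einterval 0 (ereal w)) ?f"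
      "(LBINT x=0..ereal w. ?f x) = (LBINT x=-\<infinity>..\<infinity>. g' x *\<^sub>R ?f (g x))"
    by (rule interval_integral_substitution_complex[OF _ _ _ _ _ A B int];
       use D C C' gp in \<open>force simp: set_borel_measurable_def less_imp_le\<close>)+
  have ind: "indicator {0<..<w} x *\<^sub>R ?f x = ?f x" for x
    by (auto simp: euler_kernel_def split: split_indicator)
  have "integrable lborel ?f"
    using sub(1) unfolding e set_integrable_def ind .
  moreover have "(\<integral>x. ?f x \<partial>lborel) = of_real w powr (a + b - 1) * Beta a b"
    using sub(2) True has_bochner_integral_Beta_logistic[OF assms]
    by (simp add: interval_lebesgue_integral_def e set_lebesgue_integral_def ind zero_ereal_def eq has_bochner_integral_iff)
  ultimately show ?thesis
    using True by (simp add: has_bochner_integral_iff euler_kernel_def)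
qed

lemma norm_euler_kernel_convolution:
  assumes "Re a > 0" "Re b > 0"
  shows "has_bochner_integral lborel (\<lambda>x. norm (euler_kernel a x * euler_kernel b (w - x)))
           (Beta (Re a) (Re b) * norm (euler_kernel (a + b) w))"
proof -
  have "has_bochner_integral lborel (\<lambda>x. complex_of_real (norm (euler_kernel a x * euler_kernel b (w - x))))
           (of_real (Beta (Re a) (Re b) * norm (euler_kernel (a + b) w)))"
    using euler_kernel_convolution[of "of_real (Re a)" "of_real (Re b)" w] assms
    by (simp add: norm_mult of_real_norm_euler_kernel Beta_complex_of_real)
  then show ?thesis
    by (simp only: has_bochner_integral_iff complex_of_real_integrable_eq integral_complex_of_real of_real_eq_iff)
qed

section \<open>Fourier inversion by Gaussian damping\<close>

text \<open>A rescaling by \<open>N\<close> of the characteristic function of the standard normal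
  law.\<close>

lemma gaussian_fourier:
  fixes N s :: real
  assumes "N > 0"
  shows "has_bochner_integral lborel (\<lambda>t. of_real (exp (- ((t / N)\<^sup>2 / 2))) * iexp (t * s))
           (of_real (N * sqrt (2 * pi) * exp (- ((N * s)\<^sup>2 / 2))))"
proof -
  let ?g = "\<lambda>t. complex_of_real (exp (- (t\<^sup>2 / 2))) * iexp (t * (N * s))"
  interpret real_distribution std_normal_distribution by (rule real_dist_normal_dist)
  have g: "?g t = of_real (sqrt (2 * pi)) * (std_normal_density t *\<^sub>R iexp ((N * s) * t))" for t
    by (simp add: std_normal_density_def scaleR_conv_of_real mult_ac)
  have "integrable std_normal_distribution (\<lambda>t. iexp ((N * s) * t))"
    by (rule integrable_iexp) auto
  then have i: "integrable lborel (\<lambda>t. std_normal_density t *\<^sub>R iexp ((N * s) * t))"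
    by (subst (asm) integrable_density) auto
  have "(\<integral>t. std_normal_density t *\<^sub>R iexp ((N * s) * t) \<partial>lborel) = char std_normal_distribution (N * s)"
    unfolding char_def by (subst integral_density) auto
  then have "has_bochner_integral lborel ?g (of_real (sqrt (2 * pi) * exp (- ((N * s)\<^sup>2 / 2))))"
    unfolding g of_real_mult[of "sqrt (2 * pi)"] using i
    by - (rule has_bochner_integral_mult_right, simp add: has_bochner_integral_iff char_std_normal_distribution)
  then have "has_bochner_integral lborel (\<lambda>t. ?g (0 + (1 / N) * t)) (of_real (sqrt (2 * pi) * exp (- ((N * s)\<^sup>2 / 2))) /\<^sub>R \<bar>1 / N\<bar>)"
    using assms by (subst lborel_has_bochner_integral_real_affine_iff[symmetric]) auto
  then show ?thesis
    using assms by (simp add: scaleR_conv_of_real mult_ac)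
qed

lemma fourier_inversion:
  fixes f :: "real \<Rightarrow> complex"
  assumes f: "integrable lborel f" and cont: "continuous_on UNIV f" and bound: "\<And>x. norm (f x) \<le> C"
    and F: "\<And>t. F t = (\<integral>x. f x * iexp (- (t * x)) \<partial>lborel)" and Fint: "integrable lborel F"
  shows "(\<integral>t. F t * iexp (t * y) \<partial>lborel) = 2 * pi * f y"
proof -
  \<comment> \<open>Gaussian damping of width \<open>Suc n\<close> turns the inverse transform into a convolution of \<open>f\<close>
    with an approximate identity.\<close>
  define k :: "nat \<Rightarrow> real \<Rightarrow> complex" where "k n t = of_real (exp (- ((t / Suc n)\<^sup>2 / 2)))" for n t
  define A where "A n = (\<integral>t. F t * iexp (t * y) * k n t \<partial>lborel)" for n
  note [measurable] = borel_measurable_integrable[OF f] borel_measurable_integrable[OF Fint]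
  have [measurable]: "k n \<in> borel_measurable borel" for n
    unfolding k_def by simp
  have kint: "integrable lborel (k n)" for n
    using gaussian_fourier[of "Suc n" 0] by (simp add: has_bochner_integral_iff k_def[abs_def])
  \<comment> \<open>The damping factor is at most 1 and tends to 1 as its width grows, so
    \<open>norm (F t)\<close> dominates.\<close>
  have lim: "A \<longlonglongrightarrow> (\<integral>t. F t * iexp (t * y) \<partial>lborel)"
    unfolding A_def
  proof (rule integral_dominated_convergence[where w = "\<lambda>t. norm (F t)"])
    have "(\<lambda>n. k n t) \<longlonglongrightarrow> of_real (exp (- (0\<^sup>2 / 2)))" for t
      unfolding k_def using LIMSEQ_Suc[OF lim_const_over_n[of t]]
      by (intro tendsto_intros) auto
    then have "(\<lambda>n. F t * iexp (t * y) * k n t) \<longlonglongrightarrow> F t * iexp (t * y) * of_real (exp (- (0\<^sup>2 / 2)))" for t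
      by (rule tendsto_mult_left)
    then show "AE t in lborel. (\<lambda>n. F t * iexp (t * y) * k n t) \<longlonglongrightarrow> F t * iexp (t * y)"
      by simp
    show "AE t in lborel. norm (F t * iexp (t * y) * k n t) \<le> norm (F t)" for n
      by (auto simp: norm_mult k_def intro!: mult_left_le)
  qed (use Fint in auto)
  have A: "A n = 2 * pi * (\<integral>v. std_normal_density v *\<^sub>R f (y - v / Suc n) \<partial>lborel)" for n
  proof -
    let ?h = "\<lambda>t x. f x * iexp (t * (y - x)) * k n t"
    \<comment> \<open>Integrability in \<open>x\<close> comes from \<open>f\<close> and in
      \<open>t\<close> from the Gaussian alone; the undamped integrand has modulus independent of
      \<open>t\<close>.\<close>
    have hint: "integrable (lborel \<Otimes>\<^sub>M lborel) (\<lambda>(t, x). ?h t x)"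
    proof (rule lborel_pair.Fubini_integrable)
      show "integrable lborel (\<lambda>t. \<integral>x. norm (case (t, x) of (t, x) \<Rightarrow> ?h t x) \<partial>lborel)"
        using kint[THEN integrable_norm] by (simp add: norm_mult)
      show "AE t in lborel. integrable lborel (\<lambda>x. case (t, x) of (t, x) \<Rightarrow> ?h t x)"
      proof (intro AE_I2)
        fix t
        have "integrable lborel (\<lambda>x. f x * k n t)" using f by simp
        then show "integrable lborel (\<lambda>x. case (t, x) of (t, x) \<Rightarrow> ?h t x)"
          by (rule Bochner_Integration.integrable_bound) (auto simp: norm_mult)
      qed
    qed measurable
    have "A n = (\<integral>t. \<integral>x. ?h t x \<partial>lborel \<partial>lborel)"
      unfolding A_def
    proof (intro Bochner_Integration.integral_cong refl)
      fix t
      have "(\<integral>x. ?h t x \<partial>lborel) = (\<integral>x. (f x * iexp (- (t * x))) * (iexp (t * y) * k n t) \<partial>lborel)"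
        by (intro Bochner_Integration.integral_cong refl) (simp add: algebra_simps flip: exp_add)
      also have "\<dots> = F t * (iexp (t * y) * k n t)"
        unfolding F by (rule Bochner_Integration.integral_mult_left_zero)
      finally show "F t * iexp (t * y) * k n t = (\<integral>x. ?h t x \<partial>lborel)" by (simp add: mult_ac)
    qed
    also have "\<dots> = (\<integral>x. \<integral>t. ?h t x \<partial>lborel \<partial>lborel)"
      using lborel_pair.Fubini_integral[OF hint] by simp
    also have "\<dots> = (\<integral>x. f x * of_real (Suc n * sqrt (2 * pi) * exp (- ((Suc n * (y - x))\<^sup>2 / 2))) \<partial>lborel)"
    proof (intro Bochner_Integration.integral_cong refl)
      fix x
      have "(\<integral>t. ?h t x \<partial>lborel) = (\<integral>t. f x * (k n t * iexp (t * (y - x))) \<partial>lborel)"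
        by (simp add: mult_ac)
      also have "\<dots> = f x * (\<integral>t. k n t * iexp (t * (y - x)) \<partial>lborel)"
        by (rule Bochner_Integration.integral_mult_right_zero)
      also have "\<dots> = f x * of_real (Suc n * sqrt (2 * pi) * exp (- ((Suc n * (y - x))\<^sup>2 / 2)))"
        using gaussian_fourier[of "Suc n" "y - x"] unfolding k_def by (simp add: has_bochner_integral_iff)
      finally show "(\<integral>t. ?h t x \<partial>lborel) = \<dots>" .
    qed
    \<comment> \<open>The substitution \<open>x = y - v / Suc n\<close> makes the Gaussian weight
      the standard one and moves \<open>n\<close> into the argument of \<open>f\<close>.\<close>
    also have "\<dots> = (1 / Suc n) *\<^sub>R (\<integral>v. f (y - v / Suc n) * of_real (Suc n * sqrt (2 * pi) * exp (- (v\<^sup>2 / 2))) \<partial>lborel)"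
      by (subst lborel_integral_real_affine[where c = "- 1 / Suc n" and t = y])
         (auto simp del: of_nat_Suc of_real_mult of_real_of_nat_eq)
    also have "\<dots> = (\<integral>v. (1 / Suc n) *\<^sub>R (f (y - v / Suc n) * of_real (Suc n * sqrt (2 * pi) * exp (- (v\<^sup>2 / 2)))) \<partial>lborel)"
      by (rule integral_scaleR_right[symmetric])
    also have "\<dots> = (\<integral>v. (2 * pi) *\<^sub>R (std_normal_density v *\<^sub>R f (y - v / Suc n)) \<partial>lborel)"
    proof (intro Bochner_Integration.integral_cong refl)
      fix v
      let ?Q = "Suc n * sqrt (2 * pi) * exp (- (v\<^sup>2 / 2))"
      \<comment> \<open>Of the two factors \<open>sqrt (2 * pi)\<close> in \<open>2 * pi\<close>,
        one cancels the normalisation of the density and the other is the constant of the Gaussian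
        transform.\<close>
      have calc: "(r * r) * (1 / r * e) = (1 / Suc n) * (Suc n * r * e)" if "r \<noteq> 0" for r e :: real
        using that by simp
      have "(2 * pi) * std_normal_density v = (sqrt (2 * pi) * sqrt (2 * pi)) * (1 / sqrt (2 * pi) * exp (- (v\<^sup>2 / 2)))"
        unfolding std_normal_density_def by simp
      also have "(sqrt (2 * pi) * sqrt (2 * pi)) * (1 / sqrt (2 * pi) * exp (- (v\<^sup>2 / 2))) = (1 / Suc n) * ?Q"
        by (rule calc) simp
      finally have "complex_of_real (1 / Suc n) * of_real ?Q = of_real (2 * pi) * of_real (std_normal_density v)"
        unfolding of_real_mult[symmetric] by (rule arg_cong[OF sym])
      then have "f (y - v / Suc n) * (complex_of_real (1 / Suc n) * of_real ?Q) =
          f (y - v / Suc n) * (of_real (2 * pi) * of_real (std_normal_density v))"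
        by (rule arg_cong)
      then show "(1 / Suc n) *\<^sub>R (f (y - v / Suc n) * of_real ?Q) =
         (2 * pi) *\<^sub>R (std_normal_density v *\<^sub>R f (y - v / Suc n))"
        unfolding scaleR_conv_of_real by (simp only: mult_ac)
    qed
    also have "\<dots> = 2 * pi * (\<integral>v. std_normal_density v *\<^sub>R f (y - v / Suc n) \<partial>lborel)"
      unfolding integral_scaleR_right by (simp add: scaleR_conv_of_real[of "2 * pi"])
    finally show ?thesis .
  qed
  \<comment> \<open>Continuity of \<open>f\<close> at \<open>y\<close> gives the pointwise limit,
    and the bound \<open>C\<close> gives the dominating function.\<close>
  have "(\<lambda>n. \<integral>v. std_normal_density v *\<^sub>R f (y - v / Suc n) \<partial>lborel) \<longlonglongrightarrow> (\<integral>v. std_normal_density v *\<^sub>R f y \<partial>lborel)"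
  proof (rule integral_dominated_convergence[where w = "\<lambda>v. C * std_normal_density v"])
    have "(\<lambda>n. f (y - v / Suc n)) \<longlonglongrightarrow> f y" for v
    proof (rule continuous_on_tendsto_compose[OF cont])
      show "(\<lambda>n. y - v / real (Suc n)) \<longlonglongrightarrow> y" by real_asymp
    qed auto
    then show "AE v in lborel. (\<lambda>n. std_normal_density v *\<^sub>R f (y - v / Suc n)) \<longlonglongrightarrow> std_normal_density v *\<^sub>R f y"
      by (auto intro!: tendsto_intros)
    show "AE v in lborel. norm (std_normal_density v *\<^sub>R f (y - v / Suc n)) \<le> C * std_normal_density v" for n
      using bound by (auto intro!: mult_right_mono simp: mult.commute[of "std_normal_density _"])
  qed auto
  moreover have "(\<integral>v. std_normal_density v *\<^sub>R f y \<partial>lborel) = f y"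
    by simp
  ultimately have "(\<lambda>n. 2 * pi * (\<integral>v. std_normal_density v *\<^sub>R f (y - v / Suc n) \<partial>lborel)) \<longlonglongrightarrow> 2 * pi * f y"
    by (intro tendsto_mult_left) simp
  then have "A \<longlonglongrightarrow> 2 * pi * f y"
    unfolding A[symmetric] .
  with lim show ?thesis
    by (rule LIMSEQ_unique)
qed

section \<open>Gamma on vertical lines\<close>

lemma norm_Gamma_le:
  fixes a :: complex
  assumes "Re a > 0"
  shows "norm (Gamma a) \<le> Gamma (Re a)"
proof -
  have "norm (Gamma a) \<le> (\<integral>x. norm (exp (a * of_real x - of_real (exp x))) \<partial>lborel)"
    using has_bochner_integral_Gamma_exp[OF assms] integral_norm_bound
    by (metis has_bochner_integral_integral_eq)
  also have "\<dots> = Gamma (Re a)"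
    using has_bochner_integral_Gamma_exp_real[OF assms]
    by (simp add: has_bochner_integral_iff)
  finally show ?thesis .
qed

text \<open>
  Two steps of the functional equation give quadratic decay on vertical lines, so Stirling's
  formula is not needed.
\<close>

lemma norm_Gamma_decay:
  fixes a :: complex
  assumes "Re a > 0"
  shows "norm (Gamma a) * (1 + (Im a)\<^sup>2) \<le> Gamma (Re a) + Gamma (Re a + 2)"
proof -
  have nz: "a \<notin> \<int>\<^sub>\<le>\<^sub>0" "a + 1 \<notin> \<int>\<^sub>\<le>\<^sub>0"
    using assms by (auto intro!: Re_pos_not_nonpos_Int)
  have "Gamma (a + 2) = (a + 1) * (a * Gamma a)"
    using Gamma_plus1[OF nz(1)] Gamma_plus1[OF nz(2)] by (simp add: add.assoc)
  then have "norm (Gamma a) * (norm (a + 1) * norm a) \<le> Gamma (Re a + 2)"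
    using norm_Gamma_le[of "a + 2"] assms by (simp add: norm_mult mult_ac)
  moreover have "(Im a)\<^sup>2 \<le> norm (a + 1) * norm a"
  proof -
    have "\<bar>Im a\<bar> * \<bar>Im a\<bar> \<le> norm (a + 1) * norm a"
      using abs_Im_le_cmod[of a] abs_Im_le_cmod[of "a + 1"] by (intro mult_mono) auto
    then show ?thesis by (simp add: power2_eq_square)
  qed
  ultimately have "norm (Gamma a) * (Im a)\<^sup>2 \<le> Gamma (Re a + 2)"
    by (meson mult_left_mono norm_ge_zero order_trans)
  then show ?thesis
    using norm_Gamma_le[OF assms] by (simp add: algebra_simps)
qed

text \<open>A line with positive real part avoids the poles, hence continuity. The factor
  \<open>c\<close> is used with the values 1 and -1, for the two directions of the line.\<close>

lemma Gamma_vertical_measurable: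
  assumes "p > 0"
  shows "(\<lambda>t. Gamma (complex_of_real p + \<i> * of_real (c * t))) \<in> borel_measurable borel"
proof -
  have "continuous_on UNIV (\<lambda>t. Gamma (complex_of_real p + \<i> * of_real (c * t)))"
    using assms by (intro continuous_at_imp_continuous_on ballI isCont_Gamma)
      (auto intro!: continuous_intros Re_pos_not_nonpos_Int)
  then show ?thesis by (rule borel_measurable_continuous_onI)
qed

text \<open>Quadratic decay of one factor suffices, the other being bounded by its value on the real
  axis.\<close>

lemma integrable_Gamma_vertical:
  fixes p q :: real
  assumes "p > 0" "q > 0"
  shows "integrable lborel (\<lambda>t. Gamma (p - \<i> * of_real t) * Gamma (q + \<i> * of_real t))"
proof (rule Bochner_Integration.integrable_bound)
  have "integrable lborel (\<lambda>x::real. inverse (1 + x\<^sup>2))"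
    using integrable_inverse_1_plus_square by (simp add: set_integrable_def)
  then show "integrable lborel (\<lambda>t. (Gamma p + Gamma (p + 2)) * Gamma q * inverse (1 + t\<^sup>2))"
    by simp
  show "(\<lambda>t. Gamma (p - \<i> * of_real t) * Gamma (q + \<i> * of_real t)) \<in> borel_measurable lborel"
    using Gamma_vertical_measurable[OF assms(1), of "-1"] Gamma_vertical_measurable[OF assms(2), of 1]
    by simp
  have "norm (Gamma (p - \<i> * of_real t)) * norm (Gamma (q + \<i> * of_real t)) \<le>
     ((Gamma p + Gamma (p + 2)) / (1 + t\<^sup>2)) * Gamma q" for t
  proof (rule mult_mono)
    have "1 + t\<^sup>2 > 0" by (simp add: add_pos_nonneg)
    then show "norm (Gamma (p - \<i> * of_real t)) \<le> (Gamma p + Gamma (p + 2)) / (1 + t\<^sup>2)"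
      using norm_Gamma_decay[of "p - \<i> * of_real t"] assms by (simp add: field_simps)
    show "norm (Gamma (q + \<i> * of_real t)) \<le> Gamma q"
      using norm_Gamma_le[of "q + \<i> * of_real t"] assms by simp
    show "0 \<le> (Gamma p + Gamma (p + 2)) / (1 + t\<^sup>2)"
      using assms by (auto intro!: divide_nonneg_nonneg add_nonneg_nonneg Gamma_real_nonneg)
  qed auto
  then have "norm (Gamma (p - \<i> * of_real t) * Gamma (q + \<i> * of_real t)) \<le>
     (Gamma p + Gamma (p + 2)) * Gamma q * inverse (1 + t\<^sup>2)" for t
    by (simp add: norm_mult divide_inverse mult_ac)
  then show "AE t in lborel. norm (Gamma (p - \<i> * of_real t) * Gamma (q + \<i> * of_real t)) \<le> norm ((Gamma p + Gamma (p + 2)) * Gamma q * inverse (1 + t\<^sup>2))"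
    unfolding real_norm_def using abs_ge_self order_trans by blast
qed

section \<open>The Mellin-Barnes integral of a binomial power\<close>

text \<open>Fourier inversion at the point \<open>ln u\<close>, applied to the logistic function
  whose transform is a Beta function. The conditions on \<open>c\<close> say that both Beta
  parameters \<open>m - c\<close> and \<open>q + c\<close> are positive.\<close>

lemma mellin_barnes_binomial:
  fixes m q c u :: real
  assumes "c < m" "- q < c" "u > 0"
  shows "(\<integral>t. (Gamma (m - (c + \<i> * of_real t)) * Gamma (q + (c + \<i> * of_real t)) * u powr (c + \<i> * of_real t)) \<partial>lborel)
     = of_real (2 * pi * Gamma (m + q) * u powr m * (1 + u) powr (- (m + q)))"
proof -
  define a where "a = m - c"
  define b where "b = q + c"
  have ab: "a > 0" "b > 0" and mq: "a + b = m + q" using assms by (auto simp: a_def b_def)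
  define y where "y = ln u"
  define f where "f = (\<lambda>x::real. complex_of_real (exp (a * x - (a + b) * ln (1 + exp x))))"
  define F where "F = (\<lambda>t::real. Beta (a - \<i> * of_real t) (b + \<i> * of_real t))"
  have p: "1 + exp x > 0" "1 + exp x \<noteq> 0" for x :: real
    using exp_gt_zero[of x] by linarith+
  \<comment> \<open>The imaginary parts cancel in the sum of the two arguments, so the denominator
    does not depend on \<open>t\<close>.\<close>
  have Fe: "F t = Gamma (a - \<i> * of_real t) * Gamma (b + \<i> * of_real t) / Gamma (a + b)" for t
    by (simp add: F_def Beta_def Gamma_complex_of_real flip: of_real_add)
  have FB: "has_bochner_integral lborel (\<lambda>x. f x * iexp (- (t * x))) (F t)" for t
    using has_bochner_integral_Beta_logistic[of "a - \<i> * of_real t" "b + \<i> * of_real t"] ab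
    by (simp add: f_def F_def algebra_simps flip: exp_of_real exp_add)
  have "(\<integral>t. F t * iexp (t * y) \<partial>lborel) = 2 * pi * f y"
  proof (rule fourier_inversion)
    show "integrable lborel f"
      using FB[of 0] by (simp add: has_bochner_integral_iff)
    show "continuous_on UNIV f"
      unfolding f_def using p by (auto intro!: continuous_intros)
    show "norm (f x) \<le> 1" for x
    proof -
      \<comment> \<open>Both \<open>a * (x - ln (1 + exp x))\<close> and
        \<open>- b * ln (1 + exp x)\<close> are nonpositive, which bounds the exponential by
        1.\<close>
      have "x \<le> ln (1 + exp x)" using p[of x] by (simp add: ln_ge_iff)
      moreover have "0 \<le> ln (1 + exp x)" by simp
      ultimately have "a * x \<le> a * ln (1 + exp x)" "0 \<le> b * ln (1 + exp x)" using ab by auto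
      then show ?thesis by (simp add: f_def algebra_simps)
    qed
    show "F t = (\<integral>x. f x * iexp (- (t * x)) \<partial>lborel)" for t
      using FB[of t] by (simp add: has_bochner_integral_iff)
    show "integrable lborel F"
      unfolding Fe using integrable_Gamma_vertical[OF ab(1,2)] by simp
  qed
  have "(Gamma (m - (c + \<i> * of_real t)) * Gamma (q + (c + \<i> * of_real t)) * u powr (c + \<i> * of_real t))
     = of_real (Gamma (a + b) * u powr c) * (F t * iexp (t * y))" for t
  proof -
    have "Gamma (a + b) \<noteq> 0" using Gamma_real_pos[of "a + b"] ab by linarith
    moreover have eqs: "u powr (c + \<i> * of_real t) = of_real (u powr c) * iexp (t * y)"
      using assms by (simp add: powr_def Ln_of_real y_def exp_add[symmetric] algebra_simps flip: exp_of_real)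
    moreover have eqs': "m - (c + \<i> * of_real t) = a - \<i> * of_real t" "q + (c + \<i> * of_real t) = b + \<i> * of_real t"
      by (auto simp: a_def b_def)
    ultimately show ?thesis unfolding eqs eqs' Fe by simp
  qed
  then have "(\<integral>t. (Gamma (m - (c + \<i> * of_real t)) * Gamma (q + (c + \<i> * of_real t)) * u powr (c + \<i> * of_real t)) \<partial>lborel)
    = of_real (Gamma (a + b) * u powr c) * (2 * pi * f y)"
    using \<open>(\<integral>t. F t * iexp (t * y) \<partial>lborel) = 2 * pi * f y\<close> by simp
  also have "u powr c * exp (a * y - (a + b) * ln (1 + exp y)) = u powr m * (1 + u) powr (- (m + q))"
    using assms by (simp add: y_def powr_def exp_add[symmetric] a_def b_def algebra_simps)
  then have "of_real (Gamma (a + b) * u powr c) * (2 * pi * f y) = of_real (2 * pi * Gamma (m + q) * u powr m * (1 + u) powr (- (m + q)))"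
    unfolding f_def mq[symmetric] by (simp add: mult_ac flip: of_real_mult)
  finally show ?thesis .
qed

section \<open>The Dirichlet integral\<close>

text \<open>
  The exponent \<open>b\<close> of the remaining mass has to vary: integrating out the coordinate \<open>i\<close>
  replaces \<open>b\<close> by \<open>s i + b\<close>. The ordinary Dirichlet integral over the simplex is \<open>b = 1\<close>.
\<close>

lemma has_bochner_integral_dirichlet:
  fixes s :: "'i \<Rightarrow> complex" and b :: complex and z :: real
  assumes "finite I" "\<And>i. i \<in> I \<Longrightarrow> Re (s i) > 0" "Re b > 0"
  shows "has_bochner_integral (PiM I (\<lambda>_. lborel))
     (\<lambda>x. (\<Prod>i\<in>I. euler_kernel (s i) (x i)) * euler_kernel b (z - (\<Sum>i\<in>I. x i)))
     ((\<Prod>i\<in>I. Gamma (s i)) * Gamma b * rGamma ((\<Sum>i\<in>I. s i) + b) * euler_kernel ((\<Sum>i\<in>I. s i) + b) z)"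
  using assms
proof (induction I arbitrary: b rule: finite_induct)
  case empty
  have "Gamma b * rGamma b = 1"
    using empty Re_pos_not_nonpos_Int[of b] by (simp add: rGamma_inverse_Gamma Gamma_eq_zero_iff)
  \<comment> \<open>The empty product space is a single point with counting measure.\<close>
  then show ?case
    by (simp add: PiM_empty has_bochner_integral_iff lebesgue_integral_count_space_finite integrable_count_space)
next
  case (insert i I)
  interpret product_sigma_finite "\<lambda>_::'i. lborel :: real measure" by standard
  let ?P = "\<lambda>x. \<Prod>j\<in>I. euler_kernel (s j) (x j)"
  let ?f = "\<lambda>x. (\<Prod>j\<in>insert i I. euler_kernel (s j) (x j)) * euler_kernel b (z - (\<Sum>j\<in>insert i I. x j))"
  have pos: "Re (s i) > 0" "Re b > 0" "Re (s i + b) > 0" using insert.prems by (auto intro: add_pos_pos)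
  have IH: "has_bochner_integral (PiM I (\<lambda>_. lborel)) (\<lambda>x. ?P x * euler_kernel (s i + b) (z - (\<Sum>j\<in>I. x j)))
     ((\<Prod>j\<in>I. Gamma (s j)) * Gamma (s i + b) * rGamma ((\<Sum>j\<in>I. s j) + (s i + b)) *
       euler_kernel ((\<Sum>j\<in>I. s j) + (s i + b)) z)"
    using insert.prems pos by (intro insert.IH) auto
  have upd: "?f (x(i := y)) = ?P x * (euler_kernel (s i) y * euler_kernel b ((z - (\<Sum>j\<in>I. x j)) - y))" for x y
  proof -
    have "(\<Prod>j\<in>I. euler_kernel (s j) ((x(i := y)) j)) = ?P x" "(\<Sum>j\<in>I. (x(i := y)) j) = (\<Sum>j\<in>I. x j)"
      using insert.hyps by (auto intro!: prod.cong sum.cong)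
    then show ?thesis
      using insert.hyps by (simp add: algebra_simps)
  qed
  have inner: "(\<integral>y. ?f (x(i := y)) \<partial>lborel) = Beta (s i) b * (?P x * euler_kernel (s i + b) (z - (\<Sum>j\<in>I. x j)))" for x
    unfolding upd using euler_kernel_convolution[OF pos(1,2), of "z - (\<Sum>j\<in>I. x j)"]
    by (simp add: has_bochner_integral_iff)
  \<comment> \<open>At real exponents the convolution evaluates the inner norm integral exactly, so
    Tonelli's theorem reduces integrability to the induction hypothesis.\<close>
  have inner': "(\<integral>\<^sup>+y. norm (?f (x(i := y))) \<partial>lborel) =
      ennreal (Beta (Re (s i)) (Re b) * norm (?P x * euler_kernel (s i + b) (z - (\<Sum>j\<in>I. x j))))" for x
  proof -
    have "has_bochner_integral lborel (\<lambda>y. norm (?f (x(i := y))))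
        (norm (?P x) * (Beta (Re (s i)) (Re b) * norm (euler_kernel (s i + b) (z - (\<Sum>j\<in>I. x j)))))"
      unfolding upd norm_mult[of "?P x"]
      by (intro has_bochner_integral_mult_right norm_euler_kernel_convolution pos)
    then show ?thesis
      by (simp add: has_bochner_integral_iff nn_integral_eq_integral norm_mult mult_ac)
  qed
  have int: "integrable (PiM (insert i I) (\<lambda>_. lborel)) ?f"
  proof (rule integrableI_bounded)
    show "?f \<in> borel_measurable (PiM (insert i I) (\<lambda>_. lborel))"
      using insert.hyps by measurable
    then have "(\<integral>\<^sup>+x. norm (?f x) \<partial>PiM (insert i I) (\<lambda>_. lborel)) =
        (\<integral>\<^sup>+x. \<integral>\<^sup>+y. norm (?f (x(i := y))) \<partial>lborel \<partial>PiM I (\<lambda>_. lborel))"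
      using insert.hyps by (intro product_nn_integral_insert) auto
    also have "\<dots> < \<infinity>"
    proof -
      have "integrable (PiM I (\<lambda>_. lborel)) (\<lambda>x. Beta (Re (s i)) (Re b) * norm (?P x * euler_kernel (s i + b) (z - (\<Sum>j\<in>I. x j))))"
        using IH by (intro integrable_mult_right integrable_norm) (simp add: has_bochner_integral_iff)
      moreover have "Beta (Re (s i)) (Re b) \<ge> 0"
        using pos by (auto simp: Beta_def intro!: divide_nonneg_nonneg mult_nonneg_nonneg Gamma_real_nonneg)
      ultimately show ?thesis
        unfolding inner' by (subst nn_integral_eq_integral) auto
    qed
    finally show "(\<integral>\<^sup>+x. norm (?f x) \<partial>PiM (insert i I) (\<lambda>_. lborel)) < \<infinity>" .
  qed
  have "(\<integral>x. ?f x \<partial>PiM (insert i I) (\<lambda>_. lborel)) = (\<integral>x. \<integral>y. ?f (x(i := y)) \<partial>lborel \<partial>PiM I (\<lambda>_. lborel))"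
    using insert.hyps int by (intro product_integral_insert) auto
  also have "\<dots> = Beta (s i) b * ((\<Prod>j\<in>I. Gamma (s j)) * Gamma (s i + b) * rGamma ((\<Sum>j\<in>I. s j) + (s i + b)) *
       euler_kernel ((\<Sum>j\<in>I. s j) + (s i + b)) z)"
    unfolding inner using IH by (simp add: has_bochner_integral_iff)
  also have "\<dots> = ((\<Prod>j\<in>insert i I. Gamma (s j)) * Gamma b * rGamma ((\<Sum>j\<in>insert i I. s j) + b) * euler_kernel ((\<Sum>j\<in>insert i I. s j) + b) z)"
  proof -
    \<comment> \<open>This value is the denominator of \<open>Beta (s i) b\<close> and cancels
      against the factor supplied by the induction hypothesis.\<close>
    have "Gamma (s i + b) \<noteq> 0"
      using Re_pos_not_nonpos_Int[OF pos(3)] by (simp add: Gamma_eq_zero_iff)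
    moreover have "(\<Sum>j\<in>I. s j) + (s i + b) = (\<Sum>j\<in>insert i I. s j) + b"
      using insert.hyps by (simp add: algebra_simps)
    ultimately show ?thesis
      using insert.hyps by (simp add: Beta_def field_simps)
  qed
  finally show ?case
    using int by (simp add: has_bochner_integral_iff)
qed

section \<open>Hyperplanes and densities in product measures\<close>

text \<open>Fixing all coordinates but one leaves at most a single point of the hyperplane, so its
  measure vanishes. This lets \<open><\<close> replace \<open>\<le>\<close> in the constraint on the
  sum.\<close>

lemma AE_PiM_sum_neq:
  fixes z :: real
  assumes "finite I" "I \<noteq> {}"
  shows "AE x in PiM I (\<lambda>_. lborel). (\<Sum>i\<in>I. x i) \<noteq> z"
proof -
  from assms obtain i where "i \<in> I" by auto
  then obtain J where I: "I = insert i J" "i \<notin> J" "finite J"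
    using assms(1) by (metis Set.set_insert finite_insert)
  interpret product_sigma_finite "\<lambda>_::'a. lborel :: real measure" by standard
  let ?A = "{x \<in> space (PiM I (\<lambda>_. lborel)). (\<Sum>i\<in>I. x i) = z}"
  have A [measurable]: "?A \<in> sets (PiM I (\<lambda>_. lborel))"
    by measurable
  have "emeasure (PiM I (\<lambda>_. lborel)) ?A = (\<integral>\<^sup>+x. indicator ?A x \<partial>PiM I (\<lambda>_. lborel))"
    using A by simp
  also have "\<dots> = (\<integral>\<^sup>+x. \<integral>\<^sup>+y. indicator ?A (x(i := y)) \<partial>lborel \<partial>PiM J (\<lambda>_. lborel))"
    using product_nn_integral_insert[OF I(3,2), of "indicator ?A"] A
    unfolding I(1)[symmetric] by (auto intro!: borel_measurable_indicator)
  also have "\<dots> \<le> (\<integral>\<^sup>+x. \<integral>\<^sup>+y. indicator {z - (\<Sum>j\<in>J. x j)} y \<partial>lborel \<partial>PiM J (\<lambda>_. lborel))"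
  proof (intro nn_integral_mono)
    fix x :: "'a \<Rightarrow> real" and y
    have "(\<Sum>j\<in>J. (x(i := y)) j) = (\<Sum>j\<in>J. x j)" using I by (intro sum.cong) auto
    then show "indicator ?A (x(i := y)) \<le> (indicator {z - (\<Sum>j\<in>J. x j)} y :: ennreal)"
      using I by (auto split: split_indicator)
  qed
  also have "\<dots> = 0" by simp
  finally show ?thesis
    by (subst AE_iff_measurable[OF _ refl]) auto
qed

lemma PiM_density:
  fixes M :: "'i \<Rightarrow> 'a measure"
  assumes "product_sigma_finite M" "finite I"
    and f: "\<And>i. i \<in> I \<Longrightarrow> f i \<in> borel_measurable (M i)"
    and sf: "\<And>i. i \<in> I \<Longrightarrow> sigma_finite_measure (density (M i) (f i))"
  shows "PiM I (\<lambda>i. density (M i) (f i)) = density (PiM I M) (\<lambda>x. \<Prod>i\<in>I. f i (x i))"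
proof -
  interpret product_sigma_finite M by fact
  \<comment> \<open>Product measures are handled for families that are sigma-finite at every index,
    so outside \<open>I\<close> the original measure is kept.\<close>
  define N where "N i = (if i \<in> I then density (M i) (f i) else M i)" for i
  interpret N: product_sigma_finite N
  proof (rule product_sigma_finite.intro)
    show "sigma_finite_measure (N i)" for i
      using sf[of i] sigma_finite_measures[of i] by (cases "i \<in> I") (simp_all add: N_def)
  qed
  have "density (PiM I M) (\<lambda>x. \<Prod>i\<in>I. f i (x i)) = PiM I N"
  proof (rule N.PiM_eqI)
    show "sets (density (PiM I M) (\<lambda>x. \<Prod>i\<in>I. f i (x i))) = sets (PiM I N)"
      by (auto simp: N_def intro!: sets_PiM_cong)
    fix A assume "\<And>i. i \<in> I \<Longrightarrow> A i \<in> sets (N i)"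
    then have A: "A i \<in> sets (M i)" if "i \<in> I" for i using that by (auto simp: N_def)
    have "emeasure (density (PiM I M) (\<lambda>x. \<Prod>i\<in>I. f i (x i))) (Pi\<^sub>E I A) =
        (\<integral>\<^sup>+x. (\<Prod>i\<in>I. f i (x i)) * indicator (Pi\<^sub>E I A) x \<partial>PiM I M)"
      using A f \<open>finite I\<close> by (intro emeasure_density) (auto intro!: sets_PiM_I_finite)
    also have "\<dots> = (\<integral>\<^sup>+x. (\<Prod>i\<in>I. f i (x i) * indicator (A i) (x i)) \<partial>PiM I M)"
    proof (intro nn_integral_cong)
      fix x assume "x \<in> space (PiM I M)"
      then have "indicator (Pi\<^sub>E I A) x = (\<Prod>i\<in>I. indicator (A i) (x i) :: ennreal)"
        using \<open>finite I\<close> by (auto simp: indicator_def space_PiM PiE_def Pi_def)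
      then show "(\<Prod>i\<in>I. f i (x i)) * indicator (Pi\<^sub>E I A) x = (\<Prod>i\<in>I. f i (x i) * indicator (A i) (x i))"
        by (simp add: prod.distrib)
    qed
    also have "\<dots> = (\<Prod>i\<in>I. \<integral>\<^sup>+x. f i x * indicator (A i) x \<partial>M i)"
      using A f \<open>finite I\<close> by (intro product_nn_integral_prod) auto
    also have "\<dots> = (\<Prod>i\<in>I. emeasure (N i) (A i))"
      using A f by (intro prod.cong) (auto simp: N_def emeasure_density)
    finally show "emeasure (density (PiM I M) (\<lambda>x. \<Prod>i\<in>I. f i (x i))) (Pi\<^sub>E I A) = (\<Prod>i\<in>I. emeasure (N i) (A i))" .
  qed fact
  also have "PiM I N = PiM I (\<lambda>i. density (M i) (f i))"
    by (intro PiM_cong) (auto simp: N_def)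
  finally show ?thesis ..
qed

section \<open>The Fisher-Snedecor density as a contour integral, and the law of the sum\<close>

text \<open>Taking \<open>w = (ms - 1) * gbar\<close> out of the denominator leaves
  \<open>1 + x * g\<close>: up to scaling by \<open>x\<close> this is a beta prime density, the form
  that \<open>mellin_barnes_binomial\<close> represents.\<close>

lemma fisherF_density_eq:
  assumes "gbar > 0" "m > 0" "ms > 1" "g > 0"
  defines "x \<equiv> m / ((ms - 1) * gbar)"
  shows "fisherF_density gbar m ms g =
     Gamma (m + ms) / (Gamma m * Gamma ms) * ((x * g) powr m * (1 + x * g) powr (- (m + ms))) / g"
proof -
  define w where "w = (ms - 1) * gbar"
  have w: "w > 0" using assms by (simp add: w_def)
  have x: "x = m / w" by (simp add: x_def w_def)
  have xp: "x > 0" using assms w by (simp add: x)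
  have "m * g + w = w * (1 + x * g)" using w by (simp add: x field_simps)
  then have 1: "(m * g + w) powr (m + ms) = w powr m * w powr ms * (1 + x * g) powr (m + ms)"
    using w xp assms by (simp add: powr_mult powr_add)
  have 2: "(ms - 1) powr ms * gbar powr ms = w powr ms"
    using assms by (simp add: w_def powr_mult)
  have 3: "m powr m = x powr m * w powr m"
    using w assms(2) unfolding x by (simp add: powr_divide)
  have 4: "g powr (m - 1) = g powr m / g"
    using assms by (simp add: powr_diff)
  have 5: "(x * g) powr m = x powr m * g powr m"
    using xp assms(4) by (simp add: powr_mult)
  have "x * g > 0" using xp assms(4) by simp
  then have 6: "w powr m > 0" "w powr ms > 0" "Gamma m > 0" "Gamma ms > 0" "Gamma (m + ms) > 0"
      "(1 + x * g) powr (m + ms) > 0"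
    using w assms(1-4) by (auto intro!: Gamma_real_pos)
  have "fisherF_density gbar m ms g = m powr m * ((ms - 1) powr ms * gbar powr ms) * g powr (m - 1)
        / (Beta m ms * (m * g + w) powr (m + ms))"
    using assms by (simp add: fisherF_density_def w_def)
  then show ?thesis
    unfolding 1 2 3 4 5 powr_minus Beta_def using 6 w assms(4)
    by (simp add: field_simps del: powr_gt_zero)
qed

text \<open>With \<open>u = x * g\<close>, the power splits into a constant part and
  \<open>euler_kernel\<close>, which alone depends on \<open>g\<close> and makes both sides vanish
  for nonpositive \<open>g\<close>. The Dirichlet integral will act on this factor.\<close>

lemma fisherF_density_mellin_barnes:
  fixes gbar m ms c g :: real
  assumes "gbar > 0" "m > 0" "ms > 1" "- ms < c" "c < m"
  defines "(x :: real) \<equiv> m / ((ms - 1) * gbar)"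
  shows "complex_of_real (fisherF_density gbar m ms g) =
     1 / (2 * pi * (Gamma m * Gamma ms)) *
      (\<integral>t. Gamma (m - (c + \<i> * of_real t)) * Gamma (ms + (c + \<i> * of_real t)) * x powr (c + \<i> * of_real t)
          * euler_kernel (c + \<i> * of_real t) g \<partial>lborel)"
proof (cases "g > 0")
  case True
  have x: "x > 0" using assms by (simp add: x_def)
  let ?s = "\<lambda>t::real. c + \<i> * of_real t"
  have "(\<integral>t. Gamma (m - ?s t) * Gamma (ms + ?s t) * x powr (?s t) * euler_kernel (?s t) g \<partial>lborel)
    = (\<integral>t. Gamma (m - ?s t) * Gamma (ms + ?s t) * (of_real (x * g)) powr (?s t) / g \<partial>lborel)"
    using True x by (intro Bochner_Integration.integral_cong refl)
      (simp add: euler_kernel_def powr_diff powr_times_real)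
  also have "\<dots> = of_real (2 * pi * Gamma (m + ms) * (x * g) powr m * (1 + x * g) powr (- (m + ms))) / g"
    using mellin_barnes_binomial[of c m ms "x * g"] assms(4,5) x True by simp
  finally show ?thesis
    unfolding fisherF_density_eq[OF assms(1-3) True] x_def[symmetric] by simp
qed (simp add: fisherF_density_def euler_kernel_def)

lemma prob_sum_le_eq_integral:
  fixes M :: "'a measure" and X :: "'i \<Rightarrow> 'a \<Rightarrow> real" and f :: "'i \<Rightarrow> real \<Rightarrow> real"
  assumes "prob_space M" "finite I" "I \<noteq> {}"
    and ind: "prob_space.indep_vars M (\<lambda>_. borel) X I"
    and d: "\<And>i. i \<in> I \<Longrightarrow> distributed M lborel (X i) (\<lambda>g. ennreal (f i g))"
    and [measurable]: "\<And>i. i \<in> I \<Longrightarrow> f i \<in> borel_measurable borel"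
    and nonneg: "\<And>i g. i \<in> I \<Longrightarrow> f i g \<ge> 0"
  shows "complex_of_real (measure M {\<omega> \<in> space M. (\<Sum>i\<in>I. X i \<omega>) \<le> z}) =
    (\<integral>x. (\<Prod>i\<in>I. of_real (f i (x i))) * euler_kernel 1 (z - (\<Sum>i\<in>I. x i)) \<partial>PiM I (\<lambda>_. lborel))"
proof -
  interpret prob_space M by fact
  interpret product_sigma_finite "\<lambda>_::'i. lborel :: real measure" by standard
  let ?L = "PiM I (\<lambda>_. lborel :: real measure)"
  let ?S = "{x \<in> space ?L. (\<Sum>i\<in>I. x i) \<le> z}"
  \<comment> \<open>The law of the vector is stated on a product of \<open>borel\<close>, the
    density on a product of \<open>lborel\<close>; the two share their measurable sets.\<close>
  have sL: "sets ?L = sets (PiM I (\<lambda>_. borel))" "space ?L = space (PiM I (\<lambda>_. borel :: real measure))"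
    by (auto intro!: sets_PiM_cong sets_eq_imp_space_eq)
  have S: "?S \<in> sets ?L" by measurable
  have rv: "random_variable borel (X i)" if "i \<in> I" for i
    using distributed_measurable[OF d[OF that]] by simp
  have dd: "distr M borel (X i) = density lborel (\<lambda>g. ennreal (f i g))" if "i \<in> I" for i
    using distributed_distr_eq_density[OF d[OF that]] by (simp cong: distr_cong)
  have "distr M (PiM I (\<lambda>_. borel)) (\<lambda>\<omega>. \<lambda>i\<in>I. X i \<omega>) = PiM I (\<lambda>i. distr M borel (X i))"
    using indep_vars_iff_distr_eq_PiM'[where M' = "\<lambda>_. borel" and X = X and I = I] \<open>I \<noteq> {}\<close> rv ind by auto
  also have "\<dots> = PiM I (\<lambda>i. density lborel (\<lambda>g. ennreal (f i g)))"
    by (intro PiM_cong refl dd)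
  also have "\<dots> = density ?L (\<lambda>x. \<Prod>i\<in>I. ennreal (f i (x i)))"
  proof (rule PiM_density[OF product_sigma_finite_axioms \<open>finite I\<close>])
    fix i assume i: "i \<in> I"
    show "(\<lambda>g. ennreal (f i g)) \<in> borel_measurable lborel" using i by simp
    have "prob_space (distr M borel (X i))" by (rule prob_space_distr[OF rv[OF i]])
    then show "sigma_finite_measure (density lborel (\<lambda>g. ennreal (f i g)))"
      unfolding dd[OF i] by (rule prob_space_imp_sigma_finite)
  qed
  finally have joint: "distr M (PiM I (\<lambda>_. borel)) (\<lambda>\<omega>. \<lambda>i\<in>I. X i \<omega>) = density ?L (\<lambda>x. \<Prod>i\<in>I. ennreal (f i (x i)))" .
  have "{\<omega> \<in> space M. (\<Sum>i\<in>I. X i \<omega>) \<le> z} = (\<lambda>\<omega>. \<lambda>i\<in>I. X i \<omega>) -` ?S \<inter> space M"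
    by (auto simp: space_PiM)
  then have "emeasure M {\<omega> \<in> space M. (\<Sum>i\<in>I. X i \<omega>) \<le> z} = emeasure (distr M (PiM I (\<lambda>_. borel)) (\<lambda>\<omega>. \<lambda>i\<in>I. X i \<omega>)) ?S"
    using S rv by (subst emeasure_distr) (auto simp: sL intro!: measurable_restrict)
  also have "\<dots> = (\<integral>\<^sup>+x. (\<Prod>i\<in>I. ennreal (f i (x i))) * indicator ?S x \<partial>?L)"
    unfolding joint using S by (intro emeasure_density) auto
  also have "\<dots> = (\<integral>\<^sup>+x. ennreal ((\<Prod>i\<in>I. f i (x i)) * indicator ?S x) \<partial>?L)"
    using nonneg by (intro nn_integral_cong) (auto simp: prod_ennreal split: split_indicator)
  finally have "measure M {\<omega> \<in> space M. (\<Sum>i\<in>I. X i \<omega>) \<le> z} = (\<integral>x. (\<Prod>i\<in>I. f i (x i)) * indicator ?S x \<partial>?L)"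
    using S nonneg unfolding measure_def
    by (subst integral_eq_nn_integral) (auto intro!: prod_nonneg mult_nonneg_nonneg)
  then have "complex_of_real (measure M {\<omega> \<in> space M. (\<Sum>i\<in>I. X i \<omega>) \<le> z}) =
     (\<integral>x. complex_of_real ((\<Prod>i\<in>I. f i (x i)) * indicator ?S x) \<partial>?L)"
    by (simp only: integral_complex_of_real)
  also have "\<dots> = (\<integral>x. (\<Prod>i\<in>I. of_real (f i (x i))) * euler_kernel 1 (z - (\<Sum>i\<in>I. x i)) \<partial>?L)"
  \<comment> \<open>The indicator of the event includes the boundary and
    \<open>euler_kernel 1\<close> excludes it; they differ on a null hyperplane.\<close>
  proof (rule integral_cong_AE)
    show "AE x in ?L. complex_of_real ((\<Prod>i\<in>I. f i (x i)) * indicator ?S x) =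
        (\<Prod>i\<in>I. of_real (f i (x i))) * euler_kernel 1 (z - (\<Sum>i\<in>I. x i))"
      using AE_PiM_sum_neq[OF \<open>finite I\<close> \<open>I \<noteq> {}\<close>, of z] AE_space
      by eventually_elim (auto simp: euler_kernel_1 split: split_indicator)
  qed (use S in measurable)
  finally show ?thesis .
qed

lemma fisherF_density_nonneg:
  assumes "gbar > 0" "m > 0" "ms > 1"
  shows "fisherF_density gbar m ms g \<ge> 0"
  using assms by (auto simp: fisherF_density_def Beta_def intro!: divide_nonneg_nonneg mult_nonneg_nonneg Gamma_real_nonneg)

lemma fisherF_density_measurable [measurable]: "fisherF_density gbar m ms \<in> borel_measurable borel"
  unfolding fisherF_density_def[abs_def] by measurable

section \<open>Exchange of the contour and position integrals\<close>

lemma mellin_barnes_dirichlet_fubini: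
  fixes H :: "'i \<Rightarrow> real \<Rightarrow> complex" and c :: "'i \<Rightarrow> real"
  assumes "finite I" and c: "\<And>i. i \<in> I \<Longrightarrow> c i > 0" and H: "\<And>i. i \<in> I \<Longrightarrow> integrable lborel (H i)"
    and "z > 0"
  defines "s \<equiv> \<lambda>t i. complex_of_real (c i) + \<i> * of_real (t i)"
  shows "(\<integral>x. (\<Prod>i\<in>I. \<integral>t. H i t * euler_kernel (c i + \<i> * of_real t) (x i) \<partial>lborel) *
             euler_kernel 1 (z - (\<Sum>i\<in>I. x i)) \<partial>PiM I (\<lambda>_. lborel)) =
         (\<integral>t. rGamma (1 + (\<Sum>i\<in>I. s t i)) * (\<Prod>i\<in>I. H i (t i) * Gamma (s t i) * of_real z powr (s t i)) \<partial>PiM I (\<lambda>_. lborel))"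
proof -
  interpret product_sigma_finite "\<lambda>_::'i. lborel :: real measure" by standard
  let ?L = "PiM I (\<lambda>_. lborel :: real measure)"
  interpret L: sigma_finite_measure ?L by (rule sigma_finite) fact
  interpret LL: pair_sigma_finite ?L ?L ..
  note [measurable] = borel_measurable_integrable[OF H]
  let ?D = "\<lambda>t x. (\<Prod>i\<in>I. euler_kernel (s t i) (x i)) * euler_kernel 1 (z - (\<Sum>i\<in>I. x i))"
  let ?h = "\<lambda>t x. (\<Prod>i\<in>I. H i (t i)) * ?D t x"
  have dir: "has_bochner_integral ?L (?D t)
     ((\<Prod>i\<in>I. Gamma (s t i)) * Gamma 1 * rGamma ((\<Sum>i\<in>I. s t i) + 1) * euler_kernel ((\<Sum>i\<in>I. s t i) + 1) z)" for t
    using assms by (intro has_bochner_integral_dirichlet) (auto simp: s_def)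
  \<comment> \<open>On the contours the real parts of the exponents are fixed at \<open>c i\<close>,
    so the norm of the Dirichlet integrand is the same for all \<open>t\<close>. The double norm
    integral therefore factors.\<close>
  have nD: "norm (?D t x) = norm (?D (\<lambda>_. 0) x)" for t x
  proof -
    have "complex_of_real (norm (?D t x)) = of_real (norm (?D (\<lambda>_. 0) x))"
      by (simp only: norm_mult prod_norm[symmetric] of_real_mult of_real_prod of_real_norm_euler_kernel) (simp add: s_def)
    then show ?thesis by (simp only: of_real_eq_iff)
  qed
  have int: "integrable (?L \<Otimes>\<^sub>M ?L) (\<lambda>(t, x). ?h t x)"
  proof (rule LL.Fubini_integrable)
    show "(\<lambda>(t, x). ?h t x) \<in> borel_measurable (?L \<Otimes>\<^sub>M ?L)"
    proof -
      have "(\<lambda>p. fst p i) \<in> measurable (?L \<Otimes>\<^sub>M ?L) lborel" "(\<lambda>p. snd p i) \<in> measurable (?L \<Otimes>\<^sub>M ?L) lborel"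
        if "i \<in> I" for i
        by (rule measurable_compose[OF measurable_fst measurable_component_singleton[OF that]]
          measurable_compose[OF measurable_snd measurable_component_singleton[OF that]])+
      then show ?thesis
        unfolding case_prod_beta s_def
        by (intro borel_measurable_times borel_measurable_prod euler_kernel_measurable borel_measurable_diff
            borel_measurable_sum borel_measurable_add borel_measurable_const borel_measurable_of_real
            measurable_compose[OF _ borel_measurable_integrable[OF H]]) simp_all
    qed
    have "integrable ?L (\<lambda>t. \<Prod>i\<in>I. H i (t i))"
      using assms by (intro product_integrable_prod) auto
    then have "integrable ?L (\<lambda>t. norm (\<Prod>i\<in>I. H i (t i)) * (\<integral>x. norm (?D (\<lambda>_. 0) x) \<partial>?L))"
      by (intro integrable_mult_left integrable_norm)
    moreover have "(\<integral>x. norm (?h t x) \<partial>?L) = norm (\<Prod>i\<in>I. H i (t i)) * (\<integral>x. norm (?D (\<lambda>_. 0) x) \<partial>?L)" for t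
      by (simp only: norm_mult[of "\<Prod>i\<in>I. H i (t i)"] nD[of t] integral_mult_right_zero)
    ultimately show "integrable ?L (\<lambda>t. \<integral>x. norm (case (t, x) of (t, x) \<Rightarrow> ?h t x) \<partial>?L)"
      by (simp only: case_prod_conv)
    show "AE t in ?L. integrable ?L (\<lambda>x. case (t, x) of (t, x) \<Rightarrow> ?h t x)"
      unfolding case_prod_conv using dir by (intro AE_I2 integrable_mult_right) (auto simp: has_bochner_integral_iff)
  qed
  have "(\<Prod>i\<in>I. \<integral>t. H i t * euler_kernel (c i + \<i> * of_real t) (x i) \<partial>lborel) * euler_kernel 1 (z - (\<Sum>i\<in>I. x i))
      = (\<integral>t. ?h t x \<partial>?L)" for x
  proof -
    \<comment> \<open>For fixed \<open>x\<close>, the product of the separate contour integrals is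
      one integral over the product of the contours.\<close>
    have "(\<Prod>i\<in>I. \<integral>t. H i t * euler_kernel (c i + \<i> * of_real t) (x i) \<partial>lborel) =
        (\<integral>t. (\<Prod>i\<in>I. H i (t i) * euler_kernel (s t i) (x i)) \<partial>?L)"
      unfolding s_def
    proof (rule product_integral_prod[symmetric, OF \<open>finite I\<close>])
      fix i assume i: "i \<in> I"
      then have "integrable lborel (\<lambda>t. norm (euler_kernel (c i) (x i)) *\<^sub>R H i t)"
        using H by simp
      then show "integrable lborel (\<lambda>t. H i t * euler_kernel (c i + \<i> * of_real t) (x i))"
      proof (rule Bochner_Integration.integrable_bound)
        have "norm (euler_kernel (c i + \<i> * of_real t) (x i)) = norm (euler_kernel (c i) (x i))" for t
        proof -
          have "complex_of_real (norm (euler_kernel (c i + \<i> * of_real t) (x i))) = of_real (norm (euler_kernel (c i) (x i)))"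
            by (simp only: of_real_norm_euler_kernel) simp
          then show ?thesis by (simp only: of_real_eq_iff)
        qed
        then show "AE t in lborel. norm (H i t * euler_kernel (c i + \<i> * of_real t) (x i)) \<le> norm (norm (euler_kernel (c i) (x i)) *\<^sub>R H i t)"
          by (simp add: norm_mult)
      qed (use i in measurable)
    qed
    then show ?thesis
      by (simp add: prod.distrib mult.assoc flip: integral_mult_left_zero)
  qed
  then have "(\<integral>x. (\<Prod>i\<in>I. \<integral>t. H i t * euler_kernel (c i + \<i> * of_real t) (x i) \<partial>lborel) *
             euler_kernel 1 (z - (\<Sum>i\<in>I. x i)) \<partial>?L) = (\<integral>x. \<integral>t. ?h t x \<partial>?L \<partial>?L)"
    by simp
  also have "\<dots> = (\<integral>t. \<integral>x. ?h t x \<partial>?L \<partial>?L)"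
    using LL.Fubini_integral[OF int] by simp
  also have "\<dots> = (\<integral>t. rGamma (1 + (\<Sum>i\<in>I. s t i)) * (\<Prod>i\<in>I. H i (t i) * Gamma (s t i) * of_real z powr (s t i)) \<partial>?L)"
  proof (intro Bochner_Integration.integral_cong refl)
    fix t
    \<comment> \<open>The added 1, from the exponent of the last kernel, cancels the shift in
      \<open>euler_kernel\<close> and leaves pure powers of \<open>z\<close>.\<close>
    have "euler_kernel ((\<Sum>i\<in>I. s t i) + 1) z = (\<Prod>i\<in>I. of_real z powr (s t i))"
      using \<open>z > 0\<close> \<open>finite I\<close> by (simp add: euler_kernel_def powr_def sum_distrib_right exp_sum)
    then show "(\<integral>x. ?h t x \<partial>?L) = rGamma (1 + (\<Sum>i\<in>I. s t i)) * (\<Prod>i\<in>I. H i (t i) * Gamma (s t i) * of_real z powr (s t i))"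
      using dir[of t] by (simp add: has_bochner_integral_iff prod.distrib add.commute mult_ac)
  qed
  finally show ?thesis .
qed

section \<open>Assembly of the Fox H-function\<close>

theorem theorem2:
  fixes M :: "'a measure" and X :: "nat \<Rightarrow> 'a \<Rightarrow> real" and L :: nat
    and gbar m ms :: "nat \<Rightarrow> real" and z :: real and cs :: "real list"
  assumes "prob_space M"
    and "L \<ge> 1"
    and "\<forall>l<L. gbar l > 0 \<and> m l > 0 \<and> ms l > 1"
    and "prob_space.indep_vars M (\<lambda>_. borel) X {..<L}"
    and "\<forall>l<L. distributed M lborel (X l)
                 (\<lambda>g. ennreal (fisherF_density (gbar l) (m l) (ms l) g))"
    and "z > 0"
    and "mfox_admissible 0 []
           (map (\<lambda>l. (1, 2, [(1, 1), (1 - ms l, 1)], [(m l, 1)])) [0..<L]) cs"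
  shows "complex_of_real (measure M {\<omega> \<in> space M. (\<Sum>l<L. X l \<omega>) \<le> z}) =
     complex_of_real (1 / (\<Prod>l<L. Gamma (m l) * Gamma (ms l))) *
     mfoxH 0 [] [(0, replicate L 1)]
       (map (\<lambda>l. (1, 2, [(1, 1), (1 - ms l, 1)], [(m l, 1)])) [0..<L])
       (map (\<lambda>l. complex_of_real (m l / ((ms l - 1) * gbar l) * z)) [0..<L]) cs"
proof -
  define c where "c l = cs ! l" for l
  define x where "x l = m l / ((ms l - 1) * gbar l)" for l
  \<comment> \<open>Two of the three Gamma factors of \<open>mfox_phi\<close>; the third,
    \<open>Gamma\<close> of the contour variable itself, comes from the Dirichlet integral.\<close>
  define H where "H l t = Gamma (m l - (c l + \<i> * of_real t)) * Gamma (ms l + (c l + \<i> * of_real t)) *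
      complex_of_real (x l) powr (c l + \<i> * of_real t)" for l t
  have par: "gbar l > 0" "m l > 0" "ms l > 1" "x l > 0" if "l < L" for l
    using assms(3) that by (auto simp: x_def)
  \<comment> \<open>The pair \<open>(1, 1)\<close> stands for \<open>Gamma\<close> of the contour
    variable, with rightmost pole 0; \<open>(m l, 1)\<close> gives the first pole on the right, at
    \<open>m l\<close>.\<close>
  have c: "0 < c l" "c l < m l" if "l < L" for l
  proof -
    have "cs ! l < m l" and 0: "\<forall>j<2. (\<lambda>p. (fst p - 1) / snd p < cs ! l) ([(1, 1), (1 - ms l, 1)] ! j)"
      using assms(7) that by (simp_all add: mfox_admissible_def)
    then show "c l < m l" by (simp add: c_def)
    from 0[rule_format, of 0] show "0 < c l" by (simp add: c_def)
  qed
  have Hint: "integrable lborel (H l)" if "l < L" for l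
  proof -
    have "integrable lborel (\<lambda>t. Gamma (of_real (m l - c l) - \<i> * of_real t) * Gamma (of_real (ms l + c l) + \<i> * of_real t))"
      using par[OF that] c[OF that] by (intro integrable_Gamma_vertical) auto
    then have "integrable lborel (\<lambda>t. (x l powr c l) *\<^sub>R (Gamma (m l - (c l + \<i> * of_real t)) * Gamma (ms l + (c l + \<i> * of_real t))))"
      by (intro integrable_scaleR_right) (simp add: algebra_simps)
    then show ?thesis
    proof (rule Bochner_Integration.integrable_bound)
      have "continuous_on UNIV (\<lambda>t. complex_of_real (x l) powr (c l + \<i> * of_real t))"
        using par[OF that] by (auto intro!: continuous_intros simp: powr_def)
      then have [measurable]: "(\<lambda>t. complex_of_real (x l) powr (c l + \<i> * of_real t)) \<in> borel_measurable borel"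
        by (rule borel_measurable_continuous_onI)
      have [measurable]: "(\<lambda>t. Gamma (m l - (c l + \<i> * of_real t))) \<in> borel_measurable borel"
          "(\<lambda>t. Gamma (ms l + (c l + \<i> * of_real t))) \<in> borel_measurable borel"
        using Gamma_vertical_measurable[of "m l - c l" "-1"] Gamma_vertical_measurable[of "ms l + c l" 1] par[OF that] c[OF that]
        by (simp_all add: algebra_simps)
      show "H l \<in> borel_measurable lborel"
        unfolding H_def[abs_def] by measurable
      \<comment> \<open>Along the contour the power of \<open>x l\<close> has constant modulus
        \<open>x l powr c l\<close>.\<close>
      show "AE t in lborel. norm (H l t) \<le> norm ((x l powr c l) *\<^sub>R (Gamma (m l - (c l + \<i> * of_real t)) * Gamma (ms l + (c l + \<i> * of_real t))))"
        using par[OF that] by (auto simp: H_def norm_mult norm_powr_real_powr mult_ac)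
    qed
  qed
  let ?f = "\<lambda>l. fisherF_density (gbar l) (m l) (ms l)"
  let ?K = "\<lambda>l. 1 / (2 * pi * (Gamma (m l) * Gamma (ms l)))"
  let ?L = "PiM {..<L} (\<lambda>_. lborel :: real measure)"
  let ?s = "\<lambda>t l. complex_of_real (c l) + \<i> * of_real (t l)"
  have "complex_of_real (measure M {\<omega> \<in> space M. (\<Sum>l<L. X l \<omega>) \<le> z}) =
    (\<integral>y. (\<Prod>l<L. of_real (?f l (y l))) * euler_kernel 1 (z - (\<Sum>l<L. y l)) \<partial>?L)"
    using assms(1,2,4,5) fisherF_density_nonneg par
    by (intro prob_sum_le_eq_integral) (auto simp: lessThan_empty_iff)
  also have "\<dots> = (\<integral>y. of_real (\<Prod>l<L. ?K l) * ((\<Prod>l<L. \<integral>t. H l t * euler_kernel (c l + \<i> * of_real t) (y l) \<partial>lborel) *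
             euler_kernel 1 (z - (\<Sum>l<L. y l))) \<partial>?L)"
  proof (intro Bochner_Integration.integral_cong refl)
    fix y :: "nat \<Rightarrow> real"
    have "(\<Prod>l<L. complex_of_real (?f l (y l))) = (\<Prod>l<L. of_real (?K l) * (\<integral>t. H l t * euler_kernel (c l + \<i> * of_real t) (y l) \<partial>lborel))"
    proof (intro prod.cong refl)
      fix l assume "l \<in> {..<L}"
      then show "complex_of_real (?f l (y l)) = of_real (?K l) * (\<integral>t. H l t * euler_kernel (c l + \<i> * of_real t) (y l) \<partial>lborel)"
        unfolding H_def x_def using par[of l] c[of l] by (subst fisherF_density_mellin_barnes[where c = "c l"]) auto
    qed
    then show "(\<Prod>l<L. of_real (?f l (y l))) * euler_kernel 1 (z - (\<Sum>l<L. y l)) =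
      of_real (\<Prod>l<L. ?K l) * ((\<Prod>l<L. \<integral>t. H l t * euler_kernel (c l + \<i> * of_real t) (y l) \<partial>lborel) *
             euler_kernel 1 (z - (\<Sum>l<L. y l)))"
      by (simp only: prod.distrib of_real_prod mult.assoc)
  qed
  also have "\<dots> = of_real (\<Prod>l<L. ?K l) * (\<integral>y. (\<Prod>l<L. \<integral>t. H l t * euler_kernel (c l + \<i> * of_real t) (y l) \<partial>lborel) *
             euler_kernel 1 (z - (\<Sum>l<L. y l)) \<partial>?L)"
    by (rule integral_mult_right_zero)
  also have "(\<integral>y. (\<Prod>l<L. \<integral>t. H l t * euler_kernel (c l + \<i> * of_real t) (y l) \<partial>lborel) *
             euler_kernel 1 (z - (\<Sum>l<L. y l)) \<partial>?L) =
      (\<integral>t. rGamma (1 + (\<Sum>l<L. ?s t l)) * (\<Prod>l<L. H l (t l) * Gamma (?s t l) * of_real z powr (?s t l)) \<partial>?L)"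
    using c Hint \<open>z > 0\<close> by (intro mellin_barnes_dirichlet_fubini) auto
  also have "of_real (\<Prod>l<L. ?K l) * \<dots> = complex_of_real (1 / (\<Prod>l<L. Gamma (m l) * Gamma (ms l))) *
     mfoxH 0 [] [(0, replicate L 1)]
       (map (\<lambda>l. (1, 2, [(1, 1), (1 - ms l, 1)], [(m l, 1)])) [0..<L])
       (map (\<lambda>l. complex_of_real (m l / ((ms l - 1) * gbar l) * z)) [0..<L]) cs"
  proof -
    \<comment> \<open>Each density contributes one \<open>1 / (2 * pi)\<close>; together they form
      the prefactor of \<open>mfoxH\<close>.\<close>
    have K: "(\<Prod>l<L. ?K l) = 1 / (\<Prod>l<L. Gamma (m l) * Gamma (ms l)) * (1 / (2 * pi) ^ L)"
      by (simp add: prod_dividef prod.distrib)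
    have Psi: "mfox_Psi 0 [] [(0, replicate L 1)] (?s t) = rGamma (1 + (\<Sum>l<L. ?s t l))" for t
      by (simp add: mfox_Psi_def mfox_lin_def)
    have phi: "mfox_phi 1 2 [(1, 1), (1 - ms l, 1)] [(m l, 1)] (?s t l) *
        complex_of_real (m l / ((ms l - 1) * gbar l) * z) powr (?s t l) =
        H l (t l) * Gamma (?s t l) * of_real z powr (?s t l)" if "l < L" for t l
    proof -
      have "complex_of_real (x l * z) powr (?s t l) = of_real (x l) powr (?s t l) * of_real z powr (?s t l)"
        using par[OF that] \<open>z > 0\<close> by (simp add: powr_times_real)
      then show ?thesis
        unfolding x_def[symmetric] by (simp add: mfox_phi_def numeral_2_eq_2 H_def mult_ac)
    qed
    have "mfoxH 0 [] [(0, replicate L 1)]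
       (map (\<lambda>l. (1, 2, [(1, 1), (1 - ms l, 1)], [(m l, 1)])) [0..<L])
       (map (\<lambda>l. complex_of_real (m l / ((ms l - 1) * gbar l) * z)) [0..<L]) cs =
       of_real (1 / (2 * pi) ^ L) *
       (\<integral>t. rGamma (1 + (\<Sum>l<L. ?s t l)) * (\<Prod>l<L. H l (t l) * Gamma (?s t l) * of_real z powr (?s t l)) \<partial>?L)"
      unfolding mfoxH_def Let_def length_map length_upt minus_nat.diff_0 c_def[symmetric] Psi
      by (rule arg_cong2[of _ _ _ _ "(*)", OF refl], intro Bochner_Integration.integral_cong refl,
          rule arg_cong2[of _ _ _ _ "(*)", OF refl], intro prod.cong refl, subst phi[symmetric]) simp_all
    then show ?thesis
      unfolding K of_real_mult by (simp only: mult.assoc)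
  qed
  finally show ?thesis .
qed

end
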